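(* Let $q\le 0$ and let $F\in C^2(\mathbb{R})$ be such that $F'(t)\,t\ge 0$ for all $t\in\mathbb{R}$ and, for some $\varepsilon>0$, \[ \liminf_{|t|\to\infty}\frac{F'(t)}{t|t|^{\varepsilon}}>0 . \] Then the only globally defined solutions $u:\mathbb{R}\to\mathbb{R}$ of \[ u''''+qu''+F'(u)=0 \] are constants.
   Context: A globally defined solution is a $C^4$ function $u:\mathbb{R}\to\mathbb{R}$ satisfying the equation at every point of $\mathbb{R}$. *)

theory Defs
  imports "HOL-Analysis.Analysis"
begin

definition Ck :: "nat \<Rightarrow> (real \<Rightarrow> real) \<Rightarrow> bool" where
  "Ck k f \<longleftrightarrow> (\<forall>j<k. \<forall>x. (deriv ^^ j) f field_differentiable at x)
              \<and> continuous_on UNIV ((deriv ^^ k) f)"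

definition global_solution :: "real \<Rightarrow> (real \<Rightarrow> real) \<Rightarrow> (real \<Rightarrow> real) \<Rightarrow> bool" where
  "global_solution q F u \<longleftrightarrow>
     Ck 4 u \<and> (\<forall>x. (deriv ^^ 4) u x + q * (deriv ^^ 2) u x + deriv F (u x) = 0)"

end

theory Submission
  imports Defs
begin

text \<open>
  Put \<open>p = - q\<close>, \<open>f = F'\<close>, \<open>w = u\<^sup>2 / 2\<close> and \<open>K = u u'' - u'\<^sup>2 - p w = 2 u u'' - w'' - p w\<close>.
  The equation gives \<open>K'' = - E\<close> with \<open>E = u''\<^sup>2 + p u'\<^sup>2 + f(u) u \<ge> 0\<close>, so \<open>K\<close> is concave
  on the whole line. For the bump \<open>\<phi>(y) = (1 - y\<^sup>2)\<^sup>m\<close> centred at any \<open>x0\<close>, integration by parts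
  on \<open>[x0 - 1, x0 + 1]\<close> turns \<open>\<integral> K \<phi>\<close> into
  \<open>\<integral> E \<phi> + (2 u u'' - p w) (\<phi> + D\<^sup>2 \<phi>) - w (D\<^sup>2 \<phi> + D\<^sup>4 \<phi>)\<close>.
  If \<open>m\<close> is large, the superquadratic term \<open>f(u) u \<phi>\<close> together with \<open>u''\<^sup>2 \<phi>\<close> absorbs everything else
  up to a constant, so the local averages of \<open>K\<close> are bounded below uniformly in \<open>x0\<close>.
  A concave function with this property has slope zero everywhere; hence \<open>E = 0\<close>, so \<open>u\<close> is affine
  with \<open>f(u) u = 0\<close>, which by the growth of \<open>f\<close> forces it to be constant.
\<close>

section \<open>Polynomial bumps and their derivatives\<close>

text \<open>Each differentiation costs one power of \<open>1 - y\<^sup>2\<close> and leaves a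
  polynomial cofactor, so the step can be iterated and the cofactor is bounded on [-1, 1].\<close>

lemma DERIV_bump_times_poly:
  fixes a :: "real poly"
  obtains b :: "real poly" where
    "\<And>y. ((\<lambda>y. (1 - y\<^sup>2) ^ Suc k * poly a y) has_real_derivative (1 - y\<^sup>2) ^ k * poly b y) (at y)"
proof
  fix y :: real
  have "((\<lambda>y. (1 - y\<^sup>2) ^ Suc k) has_real_derivative real (Suc k) * ((1 - y\<^sup>2) ^ k * (- 2 * y))) (at y)"
    by (rule derivative_eq_intros refl)+ simp
  from DERIV_mult[OF this poly_DERIV[of a y]]
  show "((\<lambda>y. (1 - y\<^sup>2) ^ Suc k * poly a y) has_real_derivative
      (1 - y\<^sup>2) ^ k * poly ([:1, 0, -1:] * pderiv a + [:0, -2 * real (Suc k):] * a) y) (at y)"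
    by (rule DERIV_cong) (simp add: algebra_simps power2_eq_square)
qed

lemma poly_bounded_on_unit_interval:
  fixes a :: "real poly"
  obtains M where "M \<ge> 0" "\<And>y. \<bar>y\<bar> \<le> 1 \<Longrightarrow> \<bar>poly a y\<bar> \<le> M"
proof -
  have "compact (poly a ` {-1..1})"
    by (intro compact_continuous_image continuous_intros) auto
  then obtain M where M: "\<forall>x\<in>poly a ` {-1..1}. norm x \<le> M"
    using compact_imp_bounded bounded_iff by metis
  show thesis
  proof
    show "max M 0 \<ge> 0" by simp
    show "\<bar>poly a y\<bar> \<le> max M 0" if "\<bar>y\<bar> \<le> 1" for y
    proof -
      have "y \<in> {-1..1}" using that by auto
      then have "norm (poly a y) \<le> M" using M by blast
      then show ?thesis by simp
    qed
  qed
qed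

text \<open>For j from 1 to 4 the j-th derivative keeps n + 4 - j powers of the weight. Hence the
  first three vanish at both endpoints, which removes boundary terms, and the second and fourth are
  dominated by lower powers of the weight.\<close>

lemma bump_derivatives:
  obtains \<phi>1 \<phi>2 \<phi>3 \<phi>4 :: "real \<Rightarrow> real" and M :: real where
    "\<And>y. ((\<lambda>y. (1 - y\<^sup>2) ^ (n + 4)) has_real_derivative \<phi>1 y) (at y)"
    "\<And>y. (\<phi>1 has_real_derivative \<phi>2 y) (at y)"
    "\<And>y. (\<phi>2 has_real_derivative \<phi>3 y) (at y)"
    "\<And>y. (\<phi>3 has_real_derivative \<phi>4 y) (at y)"
    "\<And>y. \<bar>y\<bar> = 1 \<Longrightarrow> \<phi>1 y = 0 \<and> \<phi>2 y = 0 \<and> \<phi>3 y = 0"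
    "M \<ge> 0"
    "\<And>y. \<bar>y\<bar> \<le> 1 \<Longrightarrow> \<bar>\<phi>2 y\<bar> \<le> M * (1 - y\<^sup>2) ^ (n + 2)"
    "\<And>y. \<bar>y\<bar> \<le> 1 \<Longrightarrow> \<bar>\<phi>4 y\<bar> \<le> M * (1 - y\<^sup>2) ^ n"
proof -
  obtain a1 where a1: "\<And>y. ((\<lambda>y. (1 - y\<^sup>2) ^ Suc (n+3) * poly 1 y) has_real_derivative
      (1 - y\<^sup>2) ^ (n+3) * poly a1 y) (at y)"
    using DERIV_bump_times_poly[of "n+3" 1] by blast
  obtain a2 where a2: "\<And>y. ((\<lambda>y. (1 - y\<^sup>2) ^ Suc (n+2) * poly a1 y) has_real_derivative
      (1 - y\<^sup>2) ^ (n+2) * poly a2 y) (at y)"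
    using DERIV_bump_times_poly[of "n+2" a1] by blast
  obtain a3 where a3: "\<And>y. ((\<lambda>y. (1 - y\<^sup>2) ^ Suc (n+1) * poly a2 y) has_real_derivative
      (1 - y\<^sup>2) ^ (n+1) * poly a3 y) (at y)"
    using DERIV_bump_times_poly[of "n+1" a2] by blast
  obtain a4 where a4: "\<And>y. ((\<lambda>y. (1 - y\<^sup>2) ^ Suc n * poly a3 y) has_real_derivative
      (1 - y\<^sup>2) ^ n * poly a4 y) (at y)"
    using DERIV_bump_times_poly[of n a3] by blast
  obtain M2 where M2: "M2 \<ge> 0" "\<And>y. \<bar>y\<bar> \<le> 1 \<Longrightarrow> \<bar>poly a2 y\<bar> \<le> M2"
    using poly_bounded_on_unit_interval by blast
  obtain M4 where M4: "M4 \<ge> 0" "\<And>y. \<bar>y\<bar> \<le> 1 \<Longrightarrow> \<bar>poly a4 y\<bar> \<le> M4"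
    using poly_bounded_on_unit_interval by blast
  have bound: "\<bar>(1 - y\<^sup>2) ^ k * t\<bar> \<le> max M2 M4 * (1 - y\<^sup>2) ^ k"
    if "\<bar>y\<bar> \<le> 1" "\<bar>t\<bar> \<le> M2 \<or> \<bar>t\<bar> \<le> M4" for y t :: real and k
  proof -
    have "0 \<le> (1 - y\<^sup>2) ^ k"
      using that(1) by (simp add: abs_square_le_1)
    moreover have "\<bar>t\<bar> \<le> max M2 M4"
      using that(2) by auto
    ultimately have "(1 - y\<^sup>2) ^ k * \<bar>t\<bar> \<le> (1 - y\<^sup>2) ^ k * max M2 M4"
      by (rule mult_left_mono[rotated])
    then show ?thesis
      using \<open>0 \<le> (1 - y\<^sup>2) ^ k\<close> by (simp add: abs_mult mult.commute)
  qed
  have edge: "y\<^sup>2 = 1" if "\<bar>y\<bar> = 1" for y :: real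
    using that by (simp add: abs_square_eq_1)
  show thesis
  proof (rule that)
    show "((\<lambda>y. (1 - y\<^sup>2) ^ (n + 4)) has_real_derivative (1 - y\<^sup>2) ^ (n+3) * poly a1 y) (at y)" for y
      using a1[of y] by (simp add: eval_nat_numeral)
    show "((\<lambda>y. (1 - y\<^sup>2) ^ (n+3) * poly a1 y) has_real_derivative (1 - y\<^sup>2) ^ (n+2) * poly a2 y) (at y)" for y
      using a2[of y] by (simp add: eval_nat_numeral)
    show "((\<lambda>y. (1 - y\<^sup>2) ^ (n+2) * poly a2 y) has_real_derivative (1 - y\<^sup>2) ^ (n+1) * poly a3 y) (at y)" for y
      using a3[of y] by (simp add: eval_nat_numeral)
    show "((\<lambda>y. (1 - y\<^sup>2) ^ (n+1) * poly a3 y) has_real_derivative (1 - y\<^sup>2) ^ n * poly a4 y) (at y)" for y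
      using a4[of y] by simp
    show "max M2 M4 \<ge> 0" using M2(1) by simp
    show "\<bar>(1 - y\<^sup>2) ^ (n+2) * poly a2 y\<bar> \<le> max M2 M4 * (1 - y\<^sup>2) ^ (n+2)" if "\<bar>y\<bar> \<le> 1" for y
      using bound[OF that] M2(2)[OF that] by blast
    show "\<bar>(1 - y\<^sup>2) ^ n * poly a4 y\<bar> \<le> max M2 M4 * (1 - y\<^sup>2) ^ n" if "\<bar>y\<bar> \<le> 1" for y
      using bound[OF that] M4(2)[OF that] by blast
  qed (use edge in auto)
qed

section \<open>Absorption and growth inequalities\<close>

text \<open>If \<open>L\<close> is at most
  \<open>c * (\<bar>v\<bar> powr \<epsilon> * s ^ 4)\<close>, the superquadratic term wins outright.
  Otherwise \<open>\<bar>v\<bar> powr \<epsilon> * s ^ 4\<close> is at most \<open>L / c\<close>; a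
  k-th power with k \<epsilon> at least 1 bounds \<open>\<bar>v\<bar> * s ^ (4 * k)\<close>, and
  squaring bounds the left side for \<open>n = 8 * k\<close>. The exponent \<open>n\<close> does not
  depend on \<open>L\<close>.\<close>

lemma superquadratic_absorbs_quadratic:
  fixes \<epsilon> c :: real
  assumes "\<epsilon> > 0" "c > 0"
  obtains n :: nat and C :: "real \<Rightarrow> real" where
    "\<And>L v s. 0 \<le> s \<Longrightarrow> s \<le> 1 \<Longrightarrow> L * v\<^sup>2 * s ^ n \<le> c * (v\<^sup>2 * \<bar>v\<bar> powr \<epsilon>) * s ^ (n + 4) + C L"
proof -
  obtain k :: nat where k: "1 / \<epsilon> \<le> real k" using real_arch_simple by blast
  have k1: "1 \<le> real k * \<epsilon>" using k assms(1) by (simp add: field_simps)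
  \<comment> \<open>The 1 in the maximum covers the case of |v| at most 1, where |v| need not lie
    below its power with exponent k \<epsilon>.\<close>
  define \<mu> where "\<mu> L = max 1 \<bar>(L / c) ^ k\<bar>" for L
  define n where "n = 8 * k"
  have key: "L * v\<^sup>2 * s ^ n \<le> c * (v\<^sup>2 * \<bar>v\<bar> powr \<epsilon>) * s ^ (n + 4) + \<bar>L\<bar> * (\<mu> L)\<^sup>2"
    if s: "0 \<le> s" "s \<le> 1" for L v s
  proof (cases "L \<le> c * (\<bar>v\<bar> powr \<epsilon> * s ^ 4)")
    case True
    have "L * (v\<^sup>2 * s ^ n) \<le> c * (\<bar>v\<bar> powr \<epsilon> * s ^ 4) * (v\<^sup>2 * s ^ n)"
      by (rule mult_right_mono[OF True]) (use s in simp)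
    moreover have "0 \<le> \<bar>L\<bar> * (\<mu> L)\<^sup>2" by simp
    ultimately have "L * (v\<^sup>2 * s ^ n) \<le> c * (\<bar>v\<bar> powr \<epsilon> * s ^ 4) * (v\<^sup>2 * s ^ n) + \<bar>L\<bar> * (\<mu> L)\<^sup>2"
      by linarith
    then show ?thesis by (simp add: power_add mult_ac)
  next
    case False
    then have "\<bar>v\<bar> powr \<epsilon> * s ^ 4 \<le> L / c"
      using assms(2) by (simp add: field_simps)
    then have pk: "(\<bar>v\<bar> powr \<epsilon> * s ^ 4) ^ k \<le> (L / c) ^ k"
      by (rule power_mono) (use s in simp)
    have "\<bar>v\<bar> * s ^ (4 * k) \<le> \<mu> L"
    proof (cases "\<bar>v\<bar> \<le> 1")
      case True
      have "\<bar>v\<bar> * s ^ (4 * k) \<le> 1 * 1"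
        by (intro mult_mono power_le_one True s) (use s in auto)
      then show ?thesis unfolding \<mu>_def by linarith
    next
      case False
      have "(\<bar>v\<bar> powr \<epsilon>) ^ k = \<bar>v\<bar> powr (real k * \<epsilon>)"
        using False by (simp add: powr_powr flip: powr_realpow) (simp add: mult.commute)
      moreover have "\<bar>v\<bar> powr 1 \<le> \<bar>v\<bar> powr (real k * \<epsilon>)"
        using False k1 by (intro powr_mono) auto
      ultimately have "\<bar>v\<bar> \<le> (\<bar>v\<bar> powr \<epsilon>) ^ k"
        by simp
      then have "\<bar>v\<bar> * s ^ (4 * k) \<le> (\<bar>v\<bar> powr \<epsilon>) ^ k * s ^ (4 * k)"
        by (rule mult_right_mono) (use s in simp)
      also have "\<dots> = (\<bar>v\<bar> powr \<epsilon> * s ^ 4) ^ k"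
        by (simp add: power_mult_distrib power_mult)
      finally show ?thesis using pk unfolding \<mu>_def by linarith
    qed
    then have "(\<bar>v\<bar> * s ^ (4 * k))\<^sup>2 \<le> (\<mu> L)\<^sup>2"
      by (rule power_mono) (use s in simp)
    moreover have "(\<bar>v\<bar> * s ^ (4 * k))\<^sup>2 = v\<^sup>2 * s ^ n"
      by (simp add: power_mult_distrib n_def flip: power_mult)
    ultimately have "\<bar>L\<bar> * (v\<^sup>2 * s ^ n) \<le> \<bar>L\<bar> * (\<mu> L)\<^sup>2"
      by (simp add: mult_left_mono)
    moreover have "L * (v\<^sup>2 * s ^ n) \<le> \<bar>L\<bar> * (v\<^sup>2 * s ^ n)"
      by (rule mult_right_mono) (use s in auto)
    moreover have "0 \<le> c * (v\<^sup>2 * \<bar>v\<bar> powr \<epsilon>) * s ^ (n + 4)"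
      using assms s by simp
    ultimately show ?thesis by (simp add: algebra_simps)
  qed
  then show thesis by (rule that)
qed

text \<open>Far out, the positive liminf gives the bound without \<open>C\<close>; on the remaining
  bounded set the sign condition suffices once \<open>C\<close> is the value of the power term at
  \<open>T\<close>. Strict positivity far out serves later to exclude nonconstant affine
  solutions.\<close>

lemma superlinear_lower_bound:
  fixes f :: "real \<Rightarrow> real"
  assumes "\<epsilon> > 0" and sgn: "\<And>t. f t * t \<ge> 0"
    and lim: "Liminf at_infinity (\<lambda>t. ereal (f t / (t * \<bar>t\<bar> powr \<epsilon>))) > 0"
  obtains c C T where "c > 0" "\<And>t. f t * t \<ge> c * (t\<^sup>2 * \<bar>t\<bar> powr \<epsilon>) - C"
    "\<And>t. \<bar>t\<bar> \<ge> T \<Longrightarrow> f t * t > 0"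
proof -
  obtain y where y: "0 < y" "y < Liminf at_infinity (\<lambda>t. ereal (f t / (t * \<bar>t\<bar> powr \<epsilon>)))"
    using dense[OF lim] by blast
  then have "eventually (\<lambda>t. y < ereal (f t / (t * \<bar>t\<bar> powr \<epsilon>))) at_infinity"
    by (simp add: less_LiminfD)
  then obtain b where b: "\<And>t. b \<le> norm t \<Longrightarrow> y < ereal (f t / (t * \<bar>t\<bar> powr \<epsilon>))"
    unfolding eventually_at_infinity by blast
  obtain c where c: "0 < c" "ereal c < y"
    using y(1) ereal_dense2[of 0 y] by auto
  \<comment> \<open>Taking at least 1 keeps t away from 0, so the quotient can be cleared.\<close>
  define T where "T = max 1 b"
  have large: "f t * t \<ge> c * (t\<^sup>2 * \<bar>t\<bar> powr \<epsilon>)" if "\<bar>t\<bar> \<ge> T" for t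
  proof -
    have t: "\<bar>t\<bar> \<ge> 1" "b \<le> norm t" using that by (auto simp: T_def)
    have "ereal c < ereal (f t / (t * \<bar>t\<bar> powr \<epsilon>))"
      using c(2) b[OF t(2)] by (rule less_trans)
    then have "c \<le> f t / (t * \<bar>t\<bar> powr \<epsilon>)" by simp
    then have "c * (t\<^sup>2 * \<bar>t\<bar> powr \<epsilon>) \<le> f t / (t * \<bar>t\<bar> powr \<epsilon>) * (t\<^sup>2 * \<bar>t\<bar> powr \<epsilon>)"
      by (rule mult_right_mono) simp
    also have "\<dots> = f t * t"
      using t(1) by (auto simp: power2_eq_square)
    finally show ?thesis .
  qed
  show thesis
  proof
    show "c > 0" by fact
    show "f t * t > 0" if "\<bar>t\<bar> \<ge> T" for t
    proof -
      have "t \<noteq> 0" using that by (auto simp: T_def)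
      then have "c * (t\<^sup>2 * \<bar>t\<bar> powr \<epsilon>) > 0" using c(1) by simp
      then show ?thesis using large[OF that] by linarith
    qed
    show "f t * t \<ge> c * (t\<^sup>2 * \<bar>t\<bar> powr \<epsilon>) - c * (T\<^sup>2 * T powr \<epsilon>)" for t
    proof (cases "\<bar>t\<bar> \<ge> T")
      case True
      have "0 \<le> c * (T\<^sup>2 * T powr \<epsilon>)" using c(1) by simp
      then show ?thesis using large[OF True] by linarith
    next
      case False
      then have "t\<^sup>2 \<le> T\<^sup>2" "\<bar>t\<bar> powr \<epsilon> \<le> T powr \<epsilon>"
        using assms(1) by (auto simp: power2_le_iff_abs_le intro: powr_mono2)
      then have "c * (t\<^sup>2 * \<bar>t\<bar> powr \<epsilon>) \<le> c * (T\<^sup>2 * T powr \<epsilon>)"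
        using c(1) by (intro mult_left_mono mult_mono) auto
      then show ?thesis using sgn[of t] by linarith
    qed
  qed
qed

text \<open>Here \<open>v, v1, v2\<close> stand for the values of \<open>u, u', u''\<close> at a point, \<open>g\<close> for \<open>f(u) u\<close>, and
  \<open>s ^ (n + 4), \<phi>2, \<phi>4\<close> for those of the bump and its second and fourth derivatives.\<close>

lemma bump_weighted_lower_bound:
  fixes p c \<epsilon> C0 M :: real
  assumes "p \<ge> 0" and s: "0 \<le> s" "s \<le> 1"
    and \<phi>2: "\<bar>\<phi>2\<bar> \<le> M * s ^ (n + 2)" and \<phi>4: "\<bar>\<phi>4\<bar> \<le> M * s ^ n" and "M \<ge> 0"
    and g: "g \<ge> e - C0"
    and absorb: "((1 + M)\<^sup>2 + p * (1 + M) + M) * v\<^sup>2 * s ^ n \<le> e * s ^ (n + 4) + C"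
  shows "(v2\<^sup>2 + p * v1\<^sup>2 + g) * s ^ (n + 4) + (2 * (v * v2) - p * (v\<^sup>2 / 2)) * (s ^ (n + 4) + \<phi>2)
     - v\<^sup>2 / 2 * (\<phi>2 + \<phi>4) \<ge> - (\<bar>C0\<bar> + C)"
proof -
  have pow: "s ^ (n + 4) \<le> s ^ (n + 2)" "s ^ (n + 2) \<le> s ^ n"
    using s by (intro power_decreasing; simp)+
  have pos: "0 \<le> s ^ n" using s by simp
  have A: "\<bar>s ^ (n + 4) + \<phi>2\<bar> \<le> (1 + M) * s ^ (n + 2)"
    using pow(1) \<phi>2 zero_le_power[OF s(1), of "n+4"] by (simp add: algebra_simps)
  have A': "\<bar>s ^ (n + 4) + \<phi>2\<bar> \<le> (1 + M) * s ^ n"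
    using A mult_left_mono[OF pow(2), of "1 + M"] \<open>M \<ge> 0\<close> by linarith
  have B: "\<bar>\<phi>2 + \<phi>4\<bar> \<le> 2 * M * s ^ n"
    using \<phi>2 \<phi>4 mult_left_mono[OF pow(2) \<open>M \<ge> 0\<close>] by linarith
  \<comment> \<open>The weight \<open>s ^ (n + 2)\<close> is the geometric mean of
    \<open>s ^ (n + 4)\<close> and \<open>s ^ n\<close>. The inequality 2ab <= a^2 + b^2 is balanced
    so that \<open>v2\<^sup>2 * s ^ (n + 4)\<close> has coefficient exactly 1, as in the expression
    to be bounded.\<close>
  have young: "\<bar>2 * (v * v2) * (s ^ (n + 4) + \<phi>2)\<bar> \<le> v2\<^sup>2 * s ^ (n + 4) + (1 + M)\<^sup>2 * v\<^sup>2 * s ^ n"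
  proof -
    have "\<bar>2 * (v * v2) * (s ^ (n + 4) + \<phi>2)\<bar> \<le> 2 * (\<bar>v\<bar> * \<bar>v2\<bar>) * ((1 + M) * s ^ (n + 2))"
      using mult_left_mono[OF A, of "2 * (\<bar>v\<bar> * \<bar>v2\<bar>)"] by (simp add: abs_mult)
    also have "\<dots> = s ^ n * (2 * (\<bar>v2\<bar> * s\<^sup>2) * ((1 + M) * \<bar>v\<bar>))"
      by (simp add: power_add power2_eq_square)
    also have "\<dots> \<le> s ^ n * ((\<bar>v2\<bar> * s\<^sup>2)\<^sup>2 + ((1 + M) * \<bar>v\<bar>)\<^sup>2)"
      by (intro mult_left_mono sum_squares_bound pos)
    also have "\<dots> = v2\<^sup>2 * s ^ (n + 4) + (1 + M)\<^sup>2 * v\<^sup>2 * s ^ n"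
      by (simp add: power_mult_distrib power_add eval_nat_numeral algebra_simps)
    finally show ?thesis .
  qed
  have P: "\<bar>p * (v\<^sup>2 / 2) * (s ^ (n + 4) + \<phi>2)\<bar> \<le> p * (1 + M) * v\<^sup>2 * s ^ n"
  proof -
    have "\<bar>p * (v\<^sup>2 / 2) * (s ^ (n + 4) + \<phi>2)\<bar> \<le> p * (v\<^sup>2 / 2) * ((1 + M) * s ^ n)"
      using mult_left_mono[OF A', of "p * (v\<^sup>2 / 2)"] \<open>p \<ge> 0\<close> by (simp add: abs_mult)
    also have "\<dots> \<le> p * v\<^sup>2 * ((1 + M) * s ^ n)"
      using \<open>p \<ge> 0\<close> \<open>M \<ge> 0\<close> pos by (intro mult_right_mono mult_left_mono) auto
    finally show ?thesis by (simp add: algebra_simps)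
  qed
  have Q: "\<bar>v\<^sup>2 / 2 * (\<phi>2 + \<phi>4)\<bar> \<le> M * v\<^sup>2 * s ^ n"
    using mult_left_mono[OF B, of "v\<^sup>2 / 2"] by (simp add: abs_mult mult_ac)
  have G: "g * s ^ (n + 4) \<ge> e * s ^ (n + 4) - \<bar>C0\<bar>"
  proof -
    have "(e - C0) * s ^ (n + 4) \<le> g * s ^ (n + 4)"
      using g s by (intro mult_right_mono) auto
    moreover have "C0 * s ^ (n + 4) \<le> \<bar>C0\<bar> * 1"
      using s by (intro mult_mono power_le_one) auto
    ultimately show ?thesis by (simp add: left_diff_distrib)
  qed
  have R: "0 \<le> p * v1\<^sup>2 * s ^ (n + 4)"
    using \<open>p \<ge> 0\<close> s by simp
  have "(v2\<^sup>2 + p * v1\<^sup>2 + g) * s ^ (n + 4) + (2 * (v * v2) - p * (v\<^sup>2 / 2)) * (s ^ (n + 4) + \<phi>2)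
     - v\<^sup>2 / 2 * (\<phi>2 + \<phi>4)
    = v2\<^sup>2 * s ^ (n + 4) + p * v1\<^sup>2 * s ^ (n + 4) + g * s ^ (n + 4)
      + 2 * (v * v2) * (s ^ (n + 4) + \<phi>2) - p * (v\<^sup>2 / 2) * (s ^ (n + 4) + \<phi>2)
      - v\<^sup>2 / 2 * (\<phi>2 + \<phi>4)"
    by (simp only: left_diff_distrib distrib_right)
  \<comment> \<open>The coefficients of the errors in \<open>young\<close>, \<open>P\<close> and
    \<open>Q\<close> add up to the factor in \<open>absorb\<close>.\<close>
  moreover have "(1 + M)\<^sup>2 * v\<^sup>2 * s ^ n + p * (1 + M) * v\<^sup>2 * s ^ n + M * v\<^sup>2 * s ^ n \<le> e * s ^ (n + 4) + C"
    using absorb by (simp only: distrib_right)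
  ultimately show ?thesis
    using young P Q G R unfolding abs_le_iff by linarith
qed


section \<open>Concave functions with local averages bounded below\<close>

text \<open>A concave function lies below its tangents, so a nonzero slope drives it to minus
  infinity in one direction, and its bump averages with it. The assumption \<open>lower\<close>
  bounds these averages: \<open>G'\<close> integrates to zero over [-1, 1], so the weighted integral
  is at least -2C.\<close>

lemma concave_slope_zero:
  fixes K H E :: "real \<Rightarrow> real"
  assumes K: "\<And>x. (K has_real_derivative H x) (at x)"
    and H: "\<And>x. (H has_real_derivative - E x) (at x)" and E: "\<And>x. E x \<ge> 0"
    and lower: "\<And>x0. \<exists>G G'. (\<forall>y. (G has_real_derivative G' y) (at y)) \<and> G 1 = 0 \<and> G (-1) = 0 \<and>
      (\<forall>y. \<bar>y\<bar> \<le> 1 \<longrightarrow> K (x0 + y) * (1 - y\<^sup>2) ^ n \<ge> - C - G' y)"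
  shows "H z = 0"
proof (rule ccontr)
  assume nz: "H z \<noteq> 0"
  have tangent: "K x \<le> K z + H z * (x - z)" for x
  proof -
    have "- H z * (x - z) \<le> - K x - - K z"
      by (rule f''_imp_f'[of UNIV "\<lambda>x. - K x" "\<lambda>x. - H x" E])
        (auto intro!: derivative_eq_intros K H simp: E)
    then show ?thesis by simp
  qed
  let ?b = "\<lambda>y::real. (1 - y\<^sup>2) ^ n"
  define I where "I = integral {-1..1} ?b"
  have b_int: "(?b has_integral I) {-1..1}"
    unfolding I_def by (intro integrable_integral integrable_continuous_real continuous_intros)
  have b_nonneg: "0 \<le> ?b y" if "\<bar>y\<bar> \<le> 1" for y
    using that by (simp add: abs_square_le_1)
  have "I \<noteq> 0"
  proof
    assume "I = 0"
    then have "\<forall>y\<in>{-1..1}. ?b y = 0"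
      unfolding I_def by (subst (asm) integral_eq_0_iff) (auto intro!: continuous_intros b_nonneg)
    then have "?b 0 = 0" by (rule bspec) simp
    then show False by simp
  qed
  moreover have "I \<ge> 0"
    by (rule has_integral_nonneg[OF b_int]) (auto intro: b_nonneg)
  ultimately have I: "I > 0" by simp
  \<comment> \<open>At \<open>x0\<close> the tangent has dropped by \<open>B\<close>, whatever the
    sign of the slope. Within distance 1 it varies by at most \<open>\<bar>H z\<bar>\<close>, so
    \<open>K\<close> is at most -(2C + 1)/I there and its weighted integral falls below -2C.\<close>
  define B where "B = K z + \<bar>H z\<bar> + (2 * C + 1) / I"
  define x0 where "x0 = z - B / H z"
  obtain G G' where G: "\<And>y. (G has_real_derivative G' y) (at y)" "G 1 = 0" "G (-1) = 0"
    and lo: "\<And>y. \<bar>y\<bar> \<le> 1 \<Longrightarrow> K (x0 + y) * ?b y \<ge> - C - G' y"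
    using lower[of x0] by blast
  have "((\<lambda>y. - C - G' y) has_integral (- C * 1 - G 1) - (- C * (-1) - G (-1))) {-1..1}"
    by (rule fundamental_theorem_of_calculus)
      (auto intro!: derivative_eq_intros DERIV_subset[OF G(1)] simp flip: has_real_derivative_iff_has_vector_derivative)
  then have l_int: "((\<lambda>y. - C - G' y) has_integral - 2 * C) {-1..1}"
    by (simp add: G)
  have r_int: "((\<lambda>y. (K z - B + \<bar>H z\<bar>) * ?b y) has_integral (K z - B + \<bar>H z\<bar>) * I) {-1..1}"
    by (rule has_integral_mult_right[OF b_int])
  have "- 2 * C \<le> (K z - B + \<bar>H z\<bar>) * I"
  proof (rule has_integral_le[OF l_int r_int])
    fix y :: real assume "y \<in> {-1..1}"
    then have y: "\<bar>y\<bar> \<le> 1" by auto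
    have "H z * (x0 + y - z) = - B + H z * y"
      using nz by (simp add: x0_def field_simps)
    moreover have "H z * y \<le> \<bar>H z\<bar>"
      using mult_left_mono[OF y, of "\<bar>H z\<bar>"] by (simp flip: abs_mult)
    ultimately have "K (x0 + y) \<le> K z - B + \<bar>H z\<bar>"
      using tangent[of "x0 + y"] by linarith
    then have "K (x0 + y) * ?b y \<le> (K z - B + \<bar>H z\<bar>) * ?b y"
      by (rule mult_right_mono) (rule b_nonneg[OF y])
    then show "- C - G' y \<le> (K z - B + \<bar>H z\<bar>) * ?b y"
      using lo[OF y] by linarith
  qed
  also have "(K z - B + \<bar>H z\<bar>) * I = - (2 * C + 1)"
    using I by (simp add: B_def field_simps)
  finally show False by simp
qed

section \<open>Solutions of the differential equation\<close>

lemma fourth_order_solution_constant: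
  fixes u u1 u2 u3 u4 f :: "real \<Rightarrow> real" and p c \<epsilon> C0 T :: real
  assumes u: "\<And>x. (u has_real_derivative u1 x) (at x)"
    and u1: "\<And>x. (u1 has_real_derivative u2 x) (at x)"
    and u2: "\<And>x. (u2 has_real_derivative u3 x) (at x)"
    and u3: "\<And>x. (u3 has_real_derivative u4 x) (at x)"
    and eq: "\<And>x. u4 x = p * u2 x - f (u x)"
    and "p \<ge> 0" "\<epsilon> > 0" "c > 0"
    and sgn: "\<And>t. f t * t \<ge> 0"
    and growth: "\<And>t. f t * t \<ge> c * (t\<^sup>2 * \<bar>t\<bar> powr \<epsilon>) - C0"
    and pos: "\<And>t. \<bar>t\<bar> \<ge> T \<Longrightarrow> f t * t > 0"
  shows "u x = u 0"
proof -
  define K where "K x = u x * u2 x - (u1 x)\<^sup>2 - p * ((u x)\<^sup>2 / 2)" for x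
  define H where "H x = u x * u3 x - u1 x * u2 x - p * (u x * u1 x)" for x
  define E where "E x = (u2 x)\<^sup>2 + p * (u1 x)\<^sup>2 + f (u x) * u x" for x
  have K: "(K has_real_derivative H x) (at x)" for x
    unfolding K_def H_def
    by (auto intro!: derivative_eq_intros u u1 u2 simp: algebra_simps power2_eq_square)
  have H: "(H has_real_derivative - E x) (at x)" for x
    unfolding H_def E_def
    by (auto intro!: derivative_eq_intros u u1 u2 u3 simp: eq algebra_simps power2_eq_square)
  have E: "E x \<ge> 0" for x
    unfolding E_def using \<open>p \<ge> 0\<close> sgn[of "u x"] by simp
  obtain n C where absorb: "\<And>L v s. 0 \<le> s \<Longrightarrow> s \<le> 1 \<Longrightarrow>
      L * v\<^sup>2 * s ^ n \<le> c * (v\<^sup>2 * \<bar>v\<bar> powr \<epsilon>) * s ^ (n + 4) + C L"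
    by (rule superquadratic_absorbs_quadratic[OF \<open>\<epsilon> > 0\<close> \<open>c > 0\<close>]) (rule that)
  obtain \<phi>1 \<phi>2 \<phi>3 \<phi>4 M where
    \<phi>: "\<And>y. ((\<lambda>y. (1 - y\<^sup>2) ^ (n + 4)) has_real_derivative \<phi>1 y) (at y)"
    and \<phi>1: "\<And>y. (\<phi>1 has_real_derivative \<phi>2 y) (at y)"
    and \<phi>2: "\<And>y. (\<phi>2 has_real_derivative \<phi>3 y) (at y)"
    and \<phi>3: "\<And>y. (\<phi>3 has_real_derivative \<phi>4 y) (at y)"
    and edge: "\<And>y. \<bar>y\<bar> = 1 \<Longrightarrow> \<phi>1 y = 0 \<and> \<phi>2 y = 0 \<and> \<phi>3 y = 0"
    and M: "M \<ge> 0" "\<And>y. \<bar>y\<bar> \<le> 1 \<Longrightarrow> \<bar>\<phi>2 y\<bar> \<le> M * (1 - y\<^sup>2) ^ (n + 2)"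
      "\<And>y. \<bar>y\<bar> \<le> 1 \<Longrightarrow> \<bar>\<phi>4 y\<bar> \<le> M * (1 - y\<^sup>2) ^ n"
    by (rule bump_derivatives[of n]) (rule that)
  \<comment> \<open>The bound \<open>M\<close> depends on the bump and so on \<open>n\<close>; the
    absorption constant is therefore evaluated only now. The result is independent of the centre
    \<open>x0\<close>.\<close>
  define C1 where "C1 = \<bar>C0\<bar> + C ((1 + M)\<^sup>2 + p * (1 + M) + M)"
  define \<phi> where "\<phi> y = (1 - y\<^sup>2) ^ (n + 4)" for y :: real
  have \<phi>: "(\<phi> has_real_derivative \<phi>1 y) (at y)" for y
    using \<phi>[of y] by (simp add: \<phi>_def[abs_def])
  have lower: "\<exists>G G'. (\<forall>y. (G has_real_derivative G' y) (at y)) \<and> G 1 = 0 \<and> G (-1) = 0 \<and>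
      (\<forall>y. \<bar>y\<bar> \<le> 1 \<longrightarrow> K (x0 + y) * (1 - y\<^sup>2) ^ (n + 4) \<ge> - C1 - G' y)" for x0
  proof -
    have shift: "((\<lambda>y. g (x0 + y)) has_real_derivative g' (x0 + y)) (at y)"
      if "\<And>x. (g has_real_derivative g' x) (at x)" for g g' :: "real \<Rightarrow> real" and y
      using DERIV_shift[of g "g' (x0 + y)" y x0] that[of "x0 + y"] by (simp only: add.commute)
    \<comment> \<open>the boundary terms of the integrations by parts\<close>
    define G where "G y = K (x0 + y) * \<phi>1 y - H (x0 + y) * \<phi> y
      + (u (x0 + y) * u1 (x0 + y) * (\<phi> y + \<phi>2 y) - (u (x0 + y))\<^sup>2 / 2 * (\<phi>1 y + \<phi>3 y))" for y
    \<comment> \<open>The \<open>H\<close> terms cancel in the derivative of the first two products.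
      The bracket in \<open>G\<close> shifts both derivatives of w'' = u'^2 + u u'' onto the sum of
      the bump and its second derivative.\<close>
    define G' where "G' y = K (x0 + y) * \<phi>2 y + E (x0 + y) * \<phi> y
      + (((u1 (x0 + y))\<^sup>2 + u (x0 + y) * u2 (x0 + y)) * (\<phi> y + \<phi>2 y)
         - (u (x0 + y))\<^sup>2 / 2 * (\<phi>2 y + \<phi>4 y))" for y
    have "(G has_real_derivative G' y) (at y)" for y
      unfolding G_def G'_def
      by (auto intro!: derivative_eq_intros shift[OF K] shift[OF H] shift[OF u] shift[OF u1]
          \<phi> \<phi>1 \<phi>2 \<phi>3) (simp add: algebra_simps power2_eq_square)
    moreover have "G 1 = 0" "G (-1) = 0"
      using edge[of 1] edge[of "-1"] by (simp_all add: G_def \<phi>_def)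
    moreover have "K (x0 + y) * (1 - y\<^sup>2) ^ (n + 4) \<ge> - C1 - G' y" if y: "\<bar>y\<bar> \<le> 1" for y
    proof -
      let ?v = "u (x0 + y)" and ?v1 = "u1 (x0 + y)" and ?v2 = "u2 (x0 + y)"
      have s: "0 \<le> 1 - y\<^sup>2" "1 - y\<^sup>2 \<le> 1"
        using y by (simp_all add: abs_square_le_1)
      have "(?v2\<^sup>2 + p * ?v1\<^sup>2 + f ?v * ?v) * (1 - y\<^sup>2) ^ (n + 4)
          + (2 * (?v * ?v2) - p * (?v\<^sup>2 / 2)) * ((1 - y\<^sup>2) ^ (n + 4) + \<phi>2 y)
          - ?v\<^sup>2 / 2 * (\<phi>2 y + \<phi>4 y) \<ge> - C1"
        unfolding C1_def
        by (rule bump_weighted_lower_bound[OF \<open>p \<ge> 0\<close> s M(2)[OF y] M(3)[OF y] M(1) growth absorb[OF s]])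
      \<comment> \<open>Substituting K = 2 u u'' - w'' - p w into K \<phi> + G' cancels w'' and
        leaves the expression just bounded.\<close>
      then show ?thesis
        by (simp add: G'_def K_def E_def algebra_simps add_divide_distrib flip: \<phi>_def)
    qed
    ultimately show ?thesis by blast
  qed
  have "H = (\<lambda>x. 0)"
    using concave_slope_zero[OF K H E lower] by blast
  then have "E x = 0" for x
    using DERIV_unique[OF H[of x], of 0] by simp
  then have zero: "u2 x = 0" "f (u x) * u x = 0" for x
  proof -
    have "(u2 x)\<^sup>2 \<ge> 0" "p * (u1 x)\<^sup>2 \<ge> 0" using \<open>p \<ge> 0\<close> by simp_all
    then have "(u2 x)\<^sup>2 = 0" "f (u x) * u x = 0"
      using \<open>E x = 0\<close> sgn[of "u x"] unfolding E_def by linarith+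
    then show "u2 x = 0" "f (u x) * u x = 0" by simp_all
  qed
  have u1_const: "u1 x = u1 0" for x
    using DERIV_isconst_all[of u1] u1 zero(1) by metis
  have "u1 0 = 0"
  proof (rule ccontr)
    assume b: "u1 0 \<noteq> 0"
    have "((\<lambda>x. u x - u1 0 * x) has_real_derivative 0) (at x)" for x
      using u1_const[of x] by (auto intro!: derivative_eq_intros u)
    then have "u x - u1 0 * x = u 0 - u1 0 * 0" for x
      using DERIV_isconst_all[of "\<lambda>x. u x - u1 0 * x"] by blast
    \<comment> \<open>An affine function of nonzero slope attains the value |T|, where
      \<open>pos\<close> contradicts \<open>zero(2)\<close>.\<close>
    from this[of "(\<bar>T\<bar> - u 0) / u1 0"] have "u ((\<bar>T\<bar> - u 0) / u1 0) = \<bar>T\<bar>"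
      using b by simp
    then show False
      using pos[of "\<bar>T\<bar>"] zero(2) by (metis abs_ge_self abs_idempotent less_irrefl)
  qed
  then show ?thesis
    using DERIV_isconst_all[of u x 0] u u1_const by simp
qed

theorem theorem1p5:
  fixes q \<epsilon> :: real and F :: "real \<Rightarrow> real"
  assumes "q \<le> 0"
    and "Ck 2 F"
    and "\<And>t. deriv F t * t \<ge> 0"
    and "\<epsilon> > 0"
    and "Liminf at_infinity (\<lambda>t::real. ereal (deriv F t / (t * \<bar>t\<bar> powr \<epsilon>))) > 0"
  shows "\<forall>u. global_solution q F u \<longrightarrow> (\<exists>c. \<forall>x. u x = c)"
proof (intro allI impI exI)
  fix u x
  assume sol: "global_solution q F u"
  obtain c C T where growth: "c > 0" "\<And>t. deriv F t * t \<ge> c * (t\<^sup>2 * \<bar>t\<bar> powr \<epsilon>) - C"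
    "\<And>t. \<bar>t\<bar> \<ge> T \<Longrightarrow> deriv F t * t > 0"
    using superlinear_lower_bound[OF assms(4,3,5)] by metis
  have D: "((deriv ^^ j) u has_real_derivative (deriv ^^ Suc j) u x) (at x)" if "j < 4" for j x
    using sol that unfolding global_solution_def Ck_def
    by (auto simp: DERIV_deriv_iff_field_differentiable)
  \<comment> \<open>The witness left open by \<open>exI\<close> is the value at 0.\<close>
  show "u x = u 0"
  proof (rule fourth_order_solution_constant[where p = "- q" and f = "deriv F", OF _ _ _ _ _ _ assms(4) growth(1) assms(3) growth(2,3)])
    show "(u has_real_derivative (deriv ^^ 1) u x) (at x)" for x
      using D[of 0 x] by simp
    show "((deriv ^^ 1) u has_real_derivative (deriv ^^ 2) u x) (at x)" for x
      using D[of 1 x] by (simp add: eval_nat_numeral)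
    show "((deriv ^^ 2) u has_real_derivative (deriv ^^ 3) u x) (at x)" for x
      using D[of 2 x] by (simp add: eval_nat_numeral)
    show "((deriv ^^ 3) u has_real_derivative (deriv ^^ 4) u x) (at x)" for x
      using D[of 3 x] by (simp add: eval_nat_numeral)
    show "(deriv ^^ 4) u x = - q * (deriv ^^ 2) u x - deriv F (u x)" for x
    proof -
      have "(deriv ^^ 4) u x + q * (deriv ^^ 2) u x + deriv F (u x) = 0"
        using sol unfolding global_solution_def by blast
      then show ?thesis by simp
    qed
  qed (use assms(1) in simp)
qed

end
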